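(* Suppose $A$ is a finitely generated group and $\phi:A\to A$ is a monomorphism. Let $G=\langle t,A : t^{-1}at=\phi(a)\text{ for }a\in A\rangle$ be the resulting ascending HNN extension. Then: 1) If $\phi(A)$ has infinite index in $A$, this splitting of $G$ (over $A$) is not minimal, and there is no finitely generated subgroup $B$ of $G$ such that $B$ is smaller than $A$, $G$ splits as an ascending HNN extension over $B$, and this splitting over $B$ is minimal. 2) If $\phi(A)$ has finite index in $A$, then there is no finitely generated subgroup $B$ of $G$ such that $B$ is smaller than $A$ and $G$ splits as an ascending HNN extension over $B$.
   Context: For subgroups $H,K$ of a group $G$, $H$ is smaller than $K$ if $H\cap K$ has finite index in $H$ and infinite index in $K$. A group $G$ splits non-trivially over a subgroup $H$ if $G$ is an HNN extension $A\ast_H$ or an amalgamated product $A\ast_H B$ with $A\neq H\neq B$. A splitting of $G$ over $H$ is minimal if $H$ is a minimal splitting subgroup of $G$: $G$ splits non-trivially over $H$ and no subgroup $K$ over which $G$ splits non-trivially is smaller than $H$. $G$ splits as an ascending HNN extension over a subgroup $B$ if there are $s\in G$ and a monomorphism $\tau:B\to B$ such that $G=\langle s,B : s^{-1}bs=\tau(b)\text{ for all }b\in B\rangle$ (base group $B$, stable letter $s$). *)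

theory Defs
  imports "HOL-Algebra.Coset" "HOL-Algebra.Generated_Groups"
begin

section \<open>Group presentations\<close>

text \<open>A word is a list of letters \<open>(x, True)\<close>, standing for the generator \<open>x\<close>, and \<open>(x, False)\<close>,
  standing for its formal inverse. A presentation consists of a set \<open>X\<close> of generators and a set \<open>R\<close>
  of pairs of words, the defining relations \<open>l = r\<close>.\<close>

type_synonym 'x word = "('x \<times> bool) list"

abbreviation words :: "'x set \<Rightarrow> 'x word set"
  where "words X \<equiv> lists (X \<times> UNIV)"

inductive pres_step :: "'x set \<Rightarrow> ('x word \<times> 'x word) set \<Rightarrow> 'x word \<Rightarrow> 'x word \<Rightarrow> bool"
  for X R
  where
    cancel: "x \<in> X \<Longrightarrow> pres_step X R (u @ [(x, e), (x, \<not> e)] @ v) (u @ v)"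
  | relation: "(l, r) \<in> R \<Longrightarrow> pres_step X R (u @ l @ v) (u @ r @ v)"

text \<open>The classes of \<open>pres_eq X R\<close> on \<open>words X\<close> are the elements of the group with generators \<open>X\<close>
  and relations \<open>R\<close>; multiplication is induced by concatenation.\<close>

definition pres_eq :: "'x set \<Rightarrow> ('x word \<times> 'x word) set \<Rightarrow> 'x word \<Rightarrow> 'x word \<Rightarrow> bool"
  where "pres_eq X R = equivclp (pres_step X R)"

fun letter_val :: "('a, 'm) monoid_scheme \<Rightarrow> ('x \<Rightarrow> 'a) \<Rightarrow> 'x \<times> bool \<Rightarrow> 'a"
  where "letter_val G f (x, e) = (if e then f x else inv\<^bsub>G\<^esub> (f x))"

definition word_val :: "('a, 'm) monoid_scheme \<Rightarrow> ('x \<Rightarrow> 'a) \<Rightarrow> 'x word \<Rightarrow> 'a"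
  where "word_val G f w = foldr (\<lambda>l g. letter_val G f l \<otimes>\<^bsub>G\<^esub> g) w \<one>\<^bsub>G\<^esub>"

text \<open>\<open>G\<close> has the presentation with generators \<open>X\<close> and relations \<open>R\<close>, the generator \<open>x\<close> being
  interpreted as \<open>f x\<close>: evaluation of words induces an isomorphism from the presented group
  onto \<open>G\<close>.\<close>

definition has_presentation ::
    "('a, 'm) monoid_scheme \<Rightarrow> ('x \<Rightarrow> 'a) \<Rightarrow> 'x set \<Rightarrow> ('x word \<times> 'x word) set \<Rightarrow> bool"
  where "has_presentation G f X R \<longleftrightarrow>
    group G \<and> f \<in> X \<rightarrow> carrier G \<and> R \<subseteq> words X \<times> words X \<and>
    word_val G f ` words X = carrier G \<and>
    (\<forall>u\<in>words X. \<forall>v\<in>words X. word_val G f u = word_val G f v \<longleftrightarrow> pres_eq X R u v)"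

section \<open>HNN extensions and amalgamated products\<close>

text \<open>Base groups, factors and splitting subgroups are taken to be subgroups of the group that
  splits. A subgroup occurring in a presentation contributes all its elements as generators and its
  multiplication table as relations.\<close>

definition table_rels ::
    "('a, 'm) monoid_scheme \<Rightarrow> 'a set \<Rightarrow> ('a \<Rightarrow> 'x) \<Rightarrow> ('x word \<times> 'x word) set"
  where "table_rels G A i =
    {([(i a, True), (i b, True)], [(i (a \<otimes>\<^bsub>G\<^esub> b), True)]) | a b. a \<in> A \<and> b \<in> A}"

text \<open>\<open>G = \<langle>s, A : s\<^sup>-\<^sup>1 h s = \<tau> h for h \<in> H\<rangle>\<close>. The generator \<open>None\<close> is the stable letter, and
  \<open>Some a\<close> is the generator given by the element \<open>a\<close> of the base group.\<close>

definition HNN_rels ::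
    "('a, 'm) monoid_scheme \<Rightarrow> 'a set \<Rightarrow> 'a set \<Rightarrow> ('a \<Rightarrow> 'a) \<Rightarrow> ('a option word \<times> 'a option word) set"
  where "HNN_rels G A H \<tau> = table_rels G A Some \<union>
    {([(None, False), (Some h, True), (None, True)], [(Some (\<tau> h), True)]) | h. h \<in> H}"

definition HNN_extension ::
    "('a, 'm) monoid_scheme \<Rightarrow> 'a set \<Rightarrow> 'a set \<Rightarrow> 'a \<Rightarrow> ('a \<Rightarrow> 'a) \<Rightarrow> bool"
  where "HNN_extension G A H s \<tau> \<longleftrightarrow>
    subgroup A G \<and> subgroup H G \<and> H \<subseteq> A \<and> s \<in> carrier G \<and>
    \<tau> \<in> mon (G\<lparr>carrier := H\<rparr>) (G\<lparr>carrier := A\<rparr>) \<and>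
    has_presentation G (case_option s id) (insert None (Some ` A)) (HNN_rels G A H \<tau>)"

definition amalgam_rels ::
    "('a, 'm) monoid_scheme \<Rightarrow> 'a set \<Rightarrow> 'a set \<Rightarrow> 'a set \<Rightarrow> (('a + 'a) word \<times> ('a + 'a) word) set"
  where "amalgam_rels G A H B = table_rels G A Inl \<union> table_rels G B Inr \<union>
    {([(Inl h, True)], [(Inr h, True)]) | h. h \<in> H}"

definition amalgamated_product ::
    "('a, 'm) monoid_scheme \<Rightarrow> 'a set \<Rightarrow> 'a set \<Rightarrow> 'a set \<Rightarrow> bool"
  where "amalgamated_product G A H B \<longleftrightarrow>
    subgroup A G \<and> subgroup B G \<and> subgroup H G \<and> H \<subseteq> A \<and> H \<subseteq> B \<and>
    has_presentation G (case_sum id id) (A <+> B) (amalgam_rels G A H B)"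

section \<open>Splittings and minimality\<close>

definition splits_nontrivially_over :: "('a, 'm) monoid_scheme \<Rightarrow> 'a set \<Rightarrow> bool"
  where "splits_nontrivially_over G H \<longleftrightarrow>
    (\<exists>A s \<tau>. HNN_extension G A H s \<tau>) \<or>
    (\<exists>A B. amalgamated_product G A H B \<and> A \<noteq> H \<and> H \<noteq> B)"

definition ascending_HNN_extension ::
    "('a, 'm) monoid_scheme \<Rightarrow> 'a set \<Rightarrow> 'a \<Rightarrow> ('a \<Rightarrow> 'a) \<Rightarrow> bool"
  where "ascending_HNN_extension G B s \<tau> \<longleftrightarrow> HNN_extension G B B s \<tau>"

definition splits_as_ascending_HNN_over :: "('a, 'm) monoid_scheme \<Rightarrow> 'a set \<Rightarrow> bool"
  where "splits_as_ascending_HNN_over G B \<longleftrightarrow> (\<exists>s \<tau>. ascending_HNN_extension G B s \<tau>)"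

text \<open>Meant for subgroups \<open>K \<subseteq> H\<close> of \<open>G\<close>.\<close>

definition finite_index_in :: "('a, 'm) monoid_scheme \<Rightarrow> 'a set \<Rightarrow> 'a set \<Rightarrow> bool"
  where "finite_index_in G K H \<longleftrightarrow> finite (rcosets\<^bsub>G\<lparr>carrier := H\<rparr>\<^esub> K)"

definition smaller :: "('a, 'm) monoid_scheme \<Rightarrow> 'a set \<Rightarrow> 'a set \<Rightarrow> bool"
  where "smaller G H K \<longleftrightarrow>
    finite_index_in G (H \<inter> K) H \<and> \<not> finite_index_in G (H \<inter> K) K"

definition minimal_splitting_subgroup :: "('a, 'm) monoid_scheme \<Rightarrow> 'a set \<Rightarrow> bool"
  where "minimal_splitting_subgroup G H \<longleftrightarrow>
    splits_nontrivially_over G H \<and>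
    \<not> (\<exists>K. subgroup K G \<and> splits_nontrivially_over G K \<and> smaller G K H)"

definition finitely_generated_subgroup :: "('a, 'm) monoid_scheme \<Rightarrow> 'a set \<Rightarrow> bool"
  where "finitely_generated_subgroup G A \<longleftrightarrow>
    subgroup A G \<and> (\<exists>S. finite S \<and> S \<subseteq> A \<and> generate G S = A)"

end

theory Submission
  imports Defs
begin

text \<open>Conjugation by \<open>t\<close> carries the given splitting over \<open>A\<close> to one over \<open>\<phi>(A) = t\<inverse>At\<close>, so an ascending
  HNN extension with minimal base has \<open>\<phi>(A)\<close> of finite index in \<open>A\<close>.

  Let \<open>G\<close> also be an ascending HNN extension with base \<open>B\<close>, stable letter \<open>s\<close> and monomorphism \<open>\<tau>\<close>,
  where \<open>B \<inter> A\<close> has finite index in \<open>B\<close>. The height \<open>\<chi> : G \<rightarrow> \<int>\<close> with \<open>\<chi>(A) = 0\<close> and \<open>\<chi>(t) = 1\<close> is bounded on \<open>B\<close>,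
  hence vanishes there. Every element of \<open>G\<close> has the form \<open>s\<^sup>i b s\<^sup>-\<^sup>j\<close>, so \<open>\<chi>(s) \<noteq> 0\<close>, and the elements of
  \<open>A\<close>, being of height 0, have \<open>i = j\<close>. As \<open>A\<close> is finitely generated and the groups \<open>s\<^sup>nBs\<^sup>-\<^sup>n\<close> increase
  with \<open>n\<close>, one of them contains \<open>A\<close>. If \<open>\<phi>(A)\<close> has finite index in \<open>A\<close>, or \<open>\<tau>(B)\<close> in \<open>B\<close>, then \<open>G\<close>
  commensurates \<open>A\<close>, respectively \<open>B\<close>; either way \<open>A \<inter> B\<close> has finite index in \<open>A\<close>, so \<open>B\<close> is not
  smaller than \<open>A\<close>.\<close>

section \<open>Finite index up to finitely many translates\<close>

text \<open>Finitely many right cosets of \<open>K\<close> cover \<open>H\<close>. For subgroups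
  this says that \<open>H \<inter> K\<close> has finite index in \<open>H\<close>, but without
  intersections, so that transitivity and invariance under conjugation are immediate.\<close>

definition almost_contained :: "('a, 'm) monoid_scheme \<Rightarrow> 'a set \<Rightarrow> 'a set \<Rightarrow> bool"
  where "almost_contained G H K \<longleftrightarrow> (\<exists>F. finite F \<and> F \<subseteq> carrier G \<and> H \<subseteq> K <#>\<^bsub>G\<^esub> F)"

definition conjugate :: "('a, 'm) monoid_scheme \<Rightarrow> 'a \<Rightarrow> 'a set \<Rightarrow> 'a set"
  where "conjugate G g H = (\<lambda>h. g \<otimes>\<^bsub>G\<^esub> h \<otimes>\<^bsub>G\<^esub> inv\<^bsub>G\<^esub> g) ` H"

context group
begin

lemma inv_mult_cancel_left [simp]:
  "x \<in> carrier G \<Longrightarrow> y \<in> carrier G \<Longrightarrow> inv x \<otimes> (x \<otimes> y) = y"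
  by (simp flip: m_assoc)

lemma mult_inv_cancel_left [simp]:
  "x \<in> carrier G \<Longrightarrow> y \<in> carrier G \<Longrightarrow> x \<otimes> (inv x \<otimes> y) = y"
  by (simp flip: m_assoc)

text \<open>For \<open>a\<close> in \<open>H\<close>, the coset of \<open>a\<close> modulo
  \<open>H \<inter> K\<close> is the trace on \<open>H\<close> of the coset \<open>K #> a\<close>.
  So the cosets of the intersection in \<open>H\<close> match the right cosets of \<open>K\<close>
  that meet \<open>H\<close>.\<close>

lemma finite_index_in_Int_iff_almost_contained:
  assumes H: "subgroup H G" and K: "subgroup K G"
  shows "finite_index_in G (H \<inter> K) H \<longleftrightarrow> almost_contained G H K"
proof
  assume "finite_index_in G (H \<inter> K) H"
  then have "finite ((\<lambda>a. (H \<inter> K) #> a) ` H)"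
    unfolding finite_index_in_def RCOSETS_def r_coset_def
    by (simp add: UNION_singleton_eq_range)
  \<comment> \<open>Finitely many representatives, chosen in \<open>H\<close>, account for all
    cosets; they serve as the translates.\<close>
  then obtain F where F: "F \<subseteq> H" "finite F" "(\<lambda>a. (H \<inter> K) #> a) ` H = (\<lambda>a. (H \<inter> K) #> a) ` F"
    by (meson finite_subset_image order_refl)
  have "H \<subseteq> K <#> F"
  proof
    fix h assume h: "h \<in> H"
    then obtain f where f: "f \<in> F" "(H \<inter> K) #> h = (H \<inter> K) #> f" using F(3) by blast
    have "h \<in> (H \<inter> K) #> h"
      using h H K by (meson rcos_self subgroup.mem_carrier subgroups_Inter_pair)
    then show "h \<in> K <#> F" using f unfolding r_coset_def set_mult_def by auto
  qed
  then show "almost_contained G H K"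
    unfolding almost_contained_def using F(1,2) subgroup.subset[OF H] by (meson order_trans)
next
  assume "almost_contained G H K"
  then obtain F where F: "finite F" "F \<subseteq> carrier G" "H \<subseteq> K <#> F"
    unfolding almost_contained_def by blast
  have "(\<lambda>a. (H \<inter> K) #> a) ` H \<subseteq> (\<lambda>f. H \<inter> (K #> f)) ` F"
  proof
    fix C assume "C \<in> (\<lambda>a. (H \<inter> K) #> a) ` H"
    then obtain a where a: "a \<in> H" "C = (H \<inter> K) #> a" by blast
    have aG: "a \<in> carrier G" using subgroup.mem_carrier[OF H a(1)] .
    obtain f where f: "f \<in> F" "a \<in> K #> f"
      using subsetD[OF F(3) a(1)] unfolding set_mult_def r_coset_def by blast
    have eq: "K #> f = K #> a" using f F K by (metis repr_independence subsetD)
    have "C = H \<inter> (K #> a)"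
    proof
      show "C \<subseteq> H \<inter> (K #> a)"
        using a H unfolding r_coset_def by (auto intro: subgroup.m_closed)
      show "H \<inter> (K #> a) \<subseteq> C"
      proof
        fix x assume "x \<in> H \<inter> (K #> a)"
        then obtain k where k: "k \<in> K" "x = k \<otimes> a" "x \<in> H" unfolding r_coset_def by blast
        have "k \<in> carrier G" using subgroup.mem_carrier[OF K k(1)] .
        then have "k = x \<otimes> inv a" using k aG by (simp add: m_assoc)
        then have "k \<in> H" using k(3) a(1) H by (metis subgroup.m_closed subgroup.m_inv_closed)
        then show "x \<in> C" using k a unfolding r_coset_def by blast
      qed
    qed
    then show "C \<in> (\<lambda>f. H \<inter> (K #> f)) ` F" using eq f by blast
  qed
  then have "finite ((\<lambda>a. (H \<inter> K) #> a) ` H)" using F(1) finite_surj by blast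
  then show "finite_index_in G (H \<inter> K) H"
    unfolding finite_index_in_def RCOSETS_def r_coset_def
    by (simp add: UNION_singleton_eq_range)
qed

lemma almost_contained_subset: "H \<subseteq> K \<Longrightarrow> K \<subseteq> carrier G \<Longrightarrow> almost_contained G H K"
  unfolding almost_contained_def set_mult_def by (rule exI[of _ "{\<one>}"]) force

lemma almost_contained_trans:
  assumes "almost_contained G H K" "almost_contained G K L" "L \<subseteq> carrier G"
  shows "almost_contained G H L"
proof -
  obtain E F where E: "finite E" "E \<subseteq> carrier G" "H \<subseteq> K <#> E"
    and F: "finite F" "F \<subseteq> carrier G" "K \<subseteq> L <#> F"
    using assms unfolding almost_contained_def by blast
  have "H \<subseteq> (L <#> F) <#> E" using order_trans[OF E(3) mono_set_mult[OF F(3) order_refl]] .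
  also have "\<dots> = L <#> (F <#> E)" using assms E F by (simp add: set_mult_assoc)
  finally have "H \<subseteq> L <#> (F <#> E)" .
  moreover have "finite (F <#> E)" using E F unfolding set_mult_def by simp
  ultimately show ?thesis
    unfolding almost_contained_def using set_mult_closed[OF F(2) E(2)] by (intro exI conjI)
qed

section \<open>Conjugates of subgroups\<close>

lemma conjugate_closed: "g \<in> carrier G \<Longrightarrow> H \<subseteq> carrier G \<Longrightarrow> conjugate G g H \<subseteq> carrier G"
  unfolding conjugate_def by auto

lemma conjugate_mult:
  assumes "g \<in> carrier G" "h \<in> carrier G" "H \<subseteq> carrier G"
  shows "conjugate G g (conjugate G h H) = conjugate G (g \<otimes> h) H"
  unfolding conjugate_def image_image
  using assms by (intro image_cong) (auto simp: m_assoc inv_mult_group subset_iff)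

lemma conjugate_one: "H \<subseteq> carrier G \<Longrightarrow> conjugate G \<one> H = H"
  unfolding conjugate_def by (force simp: subset_iff)

lemma conjugate_subgroup_elem:
  assumes "subgroup H G" "h \<in> H"
  shows "conjugate G h H = H"
proof -
  interpret H: subgroup H G by fact
  have "x \<in> conjugate G h H" if "x \<in> H" for x
    unfolding conjugate_def
  proof
    show "x = h \<otimes> (inv h \<otimes> x \<otimes> h) \<otimes> inv h"
      using that assms(2) by (simp add: m_assoc)
    show "inv h \<otimes> x \<otimes> h \<in> H" using that assms(2) by simp
  qed
  then show ?thesis using assms(2) unfolding conjugate_def by auto
qed

lemma subgroup_conjugate:
  assumes "subgroup H G" "g \<in> carrier G"
  shows "subgroup (conjugate G g H) G"
proof -
  interpret H: subgroup H G by fact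
  show ?thesis
  proof (rule subgroupI)
    show "conjugate G g H \<subseteq> carrier G" using assms conjugate_closed H.subset by blast
    show "conjugate G g H \<noteq> {}" unfolding conjugate_def using H.one_closed by blast
  next
    fix a assume "a \<in> conjugate G g H"
    then obtain h where h: "h \<in> H" "a = g \<otimes> h \<otimes> inv g" unfolding conjugate_def by blast
    then have "inv a = g \<otimes> inv h \<otimes> inv g" using assms(2) by (simp add: inv_mult_group m_assoc)
    then show "inv a \<in> conjugate G g H" unfolding conjugate_def using h by blast
  next
    fix a b assume "a \<in> conjugate G g H" "b \<in> conjugate G g H"
    then obtain h k where h: "h \<in> H" "a = g \<otimes> h \<otimes> inv g" "k \<in> H" "b = g \<otimes> k \<otimes> inv g"
      unfolding conjugate_def by blast
    have "a \<otimes> b = g \<otimes> (h \<otimes> k) \<otimes> inv g"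
      using h assms(2) by (simp add: m_assoc)
    then show "a \<otimes> b \<in> conjugate G g H" unfolding conjugate_def using h by blast
  qed
qed

lemma almost_contained_conjugate:
  assumes "almost_contained G H K" "g \<in> carrier G" "K \<subseteq> carrier G"
  shows "almost_contained G (conjugate G g H) (conjugate G g K)"
proof -
  obtain F where F: "finite F" "F \<subseteq> carrier G" "H \<subseteq> K <#> F"
    using assms unfolding almost_contained_def by blast
  have "conjugate G g H \<subseteq> conjugate G g K <#> conjugate G g F"
  proof
    fix x assume "x \<in> conjugate G g H"
    then obtain k f where k: "k \<in> K" "f \<in> F" "x = g \<otimes> (k \<otimes> f) \<otimes> inv g"
      using F(3) unfolding conjugate_def set_mult_def by blast
    have [simp]: "k \<in> carrier G" "f \<in> carrier G" using k F assms by auto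
    have "x = (g \<otimes> k \<otimes> inv g) \<otimes> (g \<otimes> f \<otimes> inv g)"
      using k assms(2) by (simp add: m_assoc)
    then show "x \<in> conjugate G g K <#> conjugate G g F"
      unfolding conjugate_def set_mult_def using k by blast
  qed
  moreover have "finite (conjugate G g F)" unfolding conjugate_def using F by simp
  ultimately show ?thesis
    unfolding almost_contained_def using conjugate_closed F assms(2) by blast
qed

lemma conj_inv_iso:
  assumes "g \<in> carrier G"
  shows "(\<lambda>x. inv g \<otimes> x \<otimes> g) \<in> iso G G"
proof (rule isoI)
  show "(\<lambda>x. inv g \<otimes> x \<otimes> g) \<in> hom G G"
    using assms by (intro homI) (auto simp: m_assoc)
  show "bij_betw (\<lambda>x. inv g \<otimes> x \<otimes> g) (carrier G) (carrier G)"
    by (rule bij_betwI[where g = "\<lambda>x. g \<otimes> x \<otimes> inv g"])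
      (use assms in \<open>auto simp: m_assoc inv_solve_left\<close>)
qed

end

section \<open>Presentations\<close>

lemma word_val_Nil: "word_val G f [] = \<one>\<^bsub>G\<^esub>"
  by (simp add: word_val_def)

lemma word_val_Cons: "word_val G f (l # w) = letter_val G f l \<otimes>\<^bsub>G\<^esub> word_val G f w"
  by (simp add: word_val_def)

context group
begin

lemma letter_val_closed: "f \<in> X \<rightarrow> carrier G \<Longrightarrow> l \<in> X \<times> UNIV \<Longrightarrow> letter_val G f l \<in> carrier G"
  by (cases l) auto

lemma word_val_closed:
  assumes "f \<in> X \<rightarrow> carrier G" "w \<in> words X"
  shows "word_val G f w \<in> carrier G"
  using assms(2)
  by induction (simp_all add: word_val_Nil word_val_Cons letter_val_closed[OF assms(1)])

lemma word_val_append: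
  assumes "f \<in> X \<rightarrow> carrier G" "u \<in> words X" "v \<in> words X"
  shows "word_val G f (u @ v) = word_val G f u \<otimes> word_val G f v"
  using assms(2)
  by induction (simp_all add: word_val_Nil word_val_Cons letter_val_closed[OF assms(1)]
      word_val_closed[OF assms(1)] assms(3) m_assoc)

end

section \<open>Invariants of words and transport of presentations\<close>

lemma pres_eq_invariant:
  assumes "pres_eq X R u v" and "\<And>u v. pres_step X R u v \<Longrightarrow> e u = e v"
  shows "e u = e v"
  using assms(1) unfolding pres_eq_def
  by (induction rule: equivclp_induct) (auto dest: assms(2))

lemma pres_eq_relation: "(l, r) \<in> R \<Longrightarrow> pres_eq X R l r"
  using pres_step.relation[of l r R X "[]" "[]"] unfolding pres_eq_def
  by (simp add: r_into_equivclp)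

text \<open>A renaming that sends generators to generators and relations to relations turns each
  elementary step into an elementary step.\<close>

lemma pres_eq_map:
  assumes "pres_eq X R u v"
    and "\<And>x. x \<in> X \<Longrightarrow> p x \<in> Y"
    and "\<And>l r. (l, r) \<in> R \<Longrightarrow> (map (apfst p) l, map (apfst p) r) \<in> S"
  shows "pres_eq Y S (map (apfst p) u) (map (apfst p) v)"
proof -
  have step_map: "pres_step Y S (map (apfst p) u) (map (apfst p) v)" if "pres_step X R u v" for u v
    using that
  proof cases
    case (cancel x u' e v')
    then show ?thesis
      using pres_step.cancel[of "p x" Y S "map (apfst p) u'" e "map (apfst p) v'"] assms(2) by simp
  next
    case (relation l r u' v')
    then show ?thesis
      using pres_step.relation[of "map (apfst p) l" "map (apfst p) r" S Y] assms(3) by simp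
  qed
  show ?thesis
    using assms(1) unfolding pres_eq_def
  proof (induction rule: equivclp_induct)
    case base
    then show ?case by simp
  next
    case (step y z)
    then show ?case using step_map by (meson equivclp_into_equivclp)
  qed
qed

text \<open>A word renamed by \<open>p\<close> evaluates in \<open>K\<close> to the
  \<open>h\<close>-image of its value in \<open>G\<close>. Since \<open>h\<close> is injective,
  equality of values in \<open>K\<close> reduces to equality in \<open>G\<close>, hence to
  derivability from \<open>R\<close>; derivations are carried back and forth by \<open>p\<close> and
  \<open>q\<close>.\<close>

lemma has_presentation_iso:
  assumes pres: "has_presentation G f X R" and K: "group K" and h: "h \<in> iso G K"
    and p: "\<And>x. x \<in> X \<Longrightarrow> p x \<in> Y" "\<And>x. x \<in> X \<Longrightarrow> q (p x) = x"
    and q: "\<And>y. y \<in> Y \<Longrightarrow> q y \<in> X" "\<And>y. y \<in> Y \<Longrightarrow> p (q y) = y"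
    and RS: "\<And>l r. (l, r) \<in> R \<Longrightarrow> (map (apfst p) l, map (apfst p) r) \<in> S"
    and SR: "\<And>l r. (l, r) \<in> S \<Longrightarrow> (map (apfst q) l, map (apfst q) r) \<in> R"
    and S: "S \<subseteq> words Y \<times> words Y"
    and k: "\<And>x. x \<in> X \<Longrightarrow> k (p x) = h (f x)"
  shows "has_presentation K k Y S"
proof -
  interpret G: group G using pres unfolding has_presentation_def by blast
  interpret K: group K by fact
  interpret h: group_hom G K h
    using h by unfold_locales (auto simp: iso_def)
  have f: "f \<in> X \<rightarrow> carrier G" and onto: "word_val G f ` words X = carrier G"
    and eq: "\<And>u v. u \<in> words X \<Longrightarrow> v \<in> words X \<Longrightarrow>
      word_val G f u = word_val G f v \<longleftrightarrow> pres_eq X R u v"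
    using pres unfolding has_presentation_def by auto
  have bij: "bij_betw h (carrier G) (carrier K)" using h by (simp add: iso_def)
  have qw: "map (apfst q) w \<in> words X" if "w \<in> words Y" for w
    using that q(1) by (auto simp: in_lists_conv_set)
  have pw: "map (apfst p) w \<in> words Y" if "w \<in> words X" for w
    using that p(1) by (auto simp: in_lists_conv_set)
  have pq: "map (apfst p) (map (apfst q) w) = w" if "w \<in> words Y" for w
    using that q(2) by (auto simp: in_lists_conv_set intro!: map_idI)
  have val: "word_val K k (map (apfst p) w) = h (word_val G f w)" if "w \<in> words X" for w
    using that
  proof induction
    case Nil
    then show ?case by (simp add: word_val_Nil)
  next
    case (Cons l w)
    obtain x e where l: "l = (x, e)" "x \<in> X" using Cons by (cases l) auto
    then have "f x \<in> carrier G" using f by blast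
    then have "letter_val K k (apfst p l) = h (letter_val G f l)"
      using l by (simp add: k h.hom_inv)
    then show ?case
      using Cons by (simp add: word_val_Cons G.letter_val_closed[OF f] G.word_val_closed[OF f])
  qed
  have val': "word_val K k w = h (word_val G f (map (apfst q) w))" if "w \<in> words Y" for w
    using val[OF qw[OF that]] pq[OF that] by simp
  have 1: "k \<in> Y \<rightarrow> carrier K"
  proof
    fix y assume "y \<in> Y"
    then have "k y = h (f (q y))" "f (q y) \<in> carrier G" using k[of "q y"] q f by auto
    then show "k y \<in> carrier K" by simp
  qed
  have 2: "word_val K k ` words Y = carrier K"
  proof
    show "word_val K k ` words Y \<subseteq> carrier K" using K.word_val_closed[OF 1] by blast
    show "carrier K \<subseteq> word_val K k ` words Y"
    proof
      fix y assume "y \<in> carrier K"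
      then have "y \<in> h ` word_val G f ` words X" using bij onto by (simp add: bij_betw_def)
      then obtain w where "w \<in> words X" "y = h (word_val G f w)" by (elim imageE) simp
      then show "y \<in> word_val K k ` words Y" using val pw by (metis imageI)
    qed
  qed
  have 3: "word_val K k u = word_val K k v \<longleftrightarrow> pres_eq Y S u v"
    if u: "u \<in> words Y" and v: "v \<in> words Y" for u v
  proof -
    have "word_val K k u = word_val K k v \<longleftrightarrow>
        word_val G f (map (apfst q) u) = word_val G f (map (apfst q) v)"
      unfolding val'[OF u] val'[OF v]
      using bij G.word_val_closed[OF f] qw u v by (metis bij_betw_def inj_on_def)
    also have "\<dots> \<longleftrightarrow> pres_eq X R (map (apfst q) u) (map (apfst q) v)"
      using eq qw u v by blast
    also have "\<dots> \<longleftrightarrow> pres_eq Y S u v"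
    proof
      assume "pres_eq X R (map (apfst q) u) (map (apfst q) v)"
      from pres_eq_map[OF this p(1) RS] show "pres_eq Y S u v" using pq u v by simp
    next
      assume "pres_eq Y S u v"
      from pres_eq_map[OF this q(1) SR]
      show "pres_eq X R (map (apfst q) u) (map (apfst q) v)" by simp
    qed
    finally show ?thesis .
  qed
  show ?thesis
    unfolding has_presentation_def using K S 1 2 3 by blast
qed

section \<open>HNN extensions\<close>

context group
begin

section \<open>Words and exponent sums in an HNN extension\<close>

lemma HNN_relation:
  assumes "HNN_extension G A H s \<tau>" "h \<in> H"
  shows "inv s \<otimes> h \<otimes> s = \<tau> h"
proof -
  let ?X = "insert None (Some ` A)" and ?R = "HNN_rels G A H \<tau>" and ?f = "case_option s id"
  have pres: "has_presentation G ?f ?X ?R" and c: "h \<in> carrier G" "s \<in> carrier G"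
    and th: "\<tau> h \<in> carrier G"
    using assms unfolding HNN_extension_def mon_def hom_def
    by (auto dest: subgroup.mem_carrier)
  have rel: "([(None, False), (Some h, True), (None, True)], [(Some (\<tau> h), True)]) \<in> ?R"
    using assms(2) unfolding HNN_rels_def by blast
  then have "word_val G ?f [(None, False), (Some h, True), (None, True)]
      = word_val G ?f [(Some (\<tau> h), True)]"
    using pres pres_eq_relation[OF rel, of ?X] unfolding has_presentation_def by blast
  then show ?thesis using c th by (simp add: word_val_Cons word_val_Nil m_assoc)
qed

text \<open>Induction on a word representing \<open>g\<close>, one letter at a time from the left.
  Inverses of base generators fall under \<open>base\<close>, because \<open>A\<close> is closed
  under inverses.\<close>

lemma HNN_induct:
  assumes "HNN_extension G A H s \<tau>" and g: "g \<in> carrier G" and one: "P \<one>"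
    and base: "\<And>a g. a \<in> A \<Longrightarrow> g \<in> carrier G \<Longrightarrow> P g \<Longrightarrow> P (a \<otimes> g)"
    and stable: "\<And>g. g \<in> carrier G \<Longrightarrow> P g \<Longrightarrow> P (s \<otimes> g)"
    and inv_stable: "\<And>g. g \<in> carrier G \<Longrightarrow> P g \<Longrightarrow> P (inv s \<otimes> g)"
  shows "P g"
proof -
  let ?X = "insert None (Some ` A)" and ?f = "case_option s id"
  have A: "subgroup A G" and f: "?f \<in> ?X \<rightarrow> carrier G"
    and onto: "word_val G ?f ` words ?X = carrier G"
    using assms(1) unfolding HNN_extension_def has_presentation_def by auto
  obtain w where w: "w \<in> words ?X" "g = word_val G ?f w" using g onto by blast
  have "P (word_val G ?f w)"
    using w(1)
  proof induction
    case Nil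
    then show ?case by (simp add: word_val_Nil one)
  next
    case (Cons l w)
    have c: "word_val G ?f w \<in> carrier G" using Cons word_val_closed[OF f] by blast
    obtain x e where l: "l = (x, e)" "x \<in> ?X" using Cons by (cases l) auto
    show ?case
    proof (cases x)
      case None
      then show ?thesis using l c Cons stable inv_stable by (simp add: word_val_Cons)
    next
      case (Some a)
      then have "a \<in> A" "inv a \<in> A" using l A subgroup.m_inv_closed by auto
      then show ?thesis using l c Cons base Some by (simp add: word_val_Cons)
    qed
  qed
  then show ?thesis using w by simp
qed

text \<open>The height is the exponent sum of the stable letter. It is unchanged by cancellation,
  and both sides of every defining relation have sum 0, so it descends from words to
  \<open>G\<close>.\<close>

lemma HNN_height:
  assumes "HNN_extension G A H s \<tau>"
  obtains \<chi> :: "'a \<Rightarrow> int" where "\<And>g h. g \<in> carrier G \<Longrightarrow> h \<in> carrier G \<Longrightarrow> \<chi> (g \<otimes> h) = \<chi> g + \<chi> h"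
    "\<chi> s = 1" "\<And>a. a \<in> A \<Longrightarrow> \<chi> a = 0"
proof -
  let ?X = "insert None (Some ` A)" and ?R = "HNN_rels G A H \<tau>" and ?f = "case_option s id"
  have pres: "has_presentation G ?f ?X ?R" and s: "s \<in> carrier G" and A: "A \<subseteq> carrier G"
    using assms subgroup.subset unfolding HNN_extension_def by auto
  have f: "?f \<in> ?X \<rightarrow> carrier G" and onto: "word_val G ?f ` words ?X = carrier G"
    and eq: "\<And>u v. u \<in> words ?X \<Longrightarrow> v \<in> words ?X \<Longrightarrow>
      word_val G ?f u = word_val G ?f v \<longleftrightarrow> pres_eq ?X ?R u v"
    using pres unfolding has_presentation_def by auto
  define e :: "'a option word \<Rightarrow> int" where
    "e w = (\<Sum>(x, b)\<leftarrow>w. case x of None \<Rightarrow> if b then 1 else - 1 | Some _ \<Rightarrow> 0)" for w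
  have "e u = e v" if "pres_step ?X ?R u v" for u v
    using that
  proof cases
    case (cancel x u' b v')
    then show ?thesis by (cases x) (auto simp: e_def)
  next
    case (relation l r u' v')
    then show ?thesis by (auto simp: e_def HNN_rels_def table_rels_def)
  qed
  then have inv: "e u = e v" if "pres_eq ?X ?R u v" for u v
    using pres_eq_invariant[OF that, of e] by blast
  \<comment> \<open>An arbitrary word representing \<open>g\<close> is used; \<open>chi\<close>
    below shows that the choice does not matter.\<close>
  define \<chi> where "\<chi> g = e (SOME w. w \<in> words ?X \<and> word_val G ?f w = g)" for g
  have chi: "\<chi> (word_val G ?f w) = e w" if "w \<in> words ?X" for w
  proof -
    let ?v = "SOME v. v \<in> words ?X \<and> word_val G ?f v = word_val G ?f w"
    have "?v \<in> words ?X \<and> word_val G ?f ?v = word_val G ?f w"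
      by (rule someI[of _ w]) (use that in simp)
    then have "pres_eq ?X ?R ?v w" using eq that by blast
    then show ?thesis unfolding \<chi>_def by (rule inv)
  qed
  show thesis
  proof
    fix g h assume "g \<in> carrier G" "h \<in> carrier G"
    then have "g \<in> word_val G ?f ` words ?X" "h \<in> word_val G ?f ` words ?X"
      unfolding onto by auto
    then obtain u v where u: "u \<in> words ?X" "g = word_val G ?f u"
      and v: "v \<in> words ?X" "h = word_val G ?f v" by (elim imageE)
    have "g \<otimes> h = word_val G ?f (u @ v)" using u v word_val_append[OF f] by simp
    then have "\<chi> (g \<otimes> h) = e (u @ v)" using chi[of "u @ v"] u v by simp
    then show "\<chi> (g \<otimes> h) = \<chi> g + \<chi> h" using chi u v by (simp add: e_def)
  next
    show "\<chi> s = 1"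
      using chi[of "[(None, True)]"] s by (simp add: e_def word_val_Cons word_val_Nil)
  next
    fix a assume "a \<in> A"
    then show "\<chi> a = 0"
      using chi[of "[(Some a, True)]"] A by (auto simp: e_def word_val_Cons word_val_Nil)
  qed
qed

section \<open>Ascending HNN extensions: normal form and the image of the base\<close>

text \<open>Since \<open>\<tau>\<close> is defined on all of \<open>B\<close>, every
  \<open>b\<close> can be pushed rightwards past \<open>s\<close> and every s^-1 rightwards past
  \<open>b\<close>. Hence left multiplication by any letter preserves the form.\<close>

lemma ascending_HNN_normal_form:
  assumes "ascending_HNN_extension G B s \<tau>" "g \<in> carrier G"
  shows "\<exists>(i :: nat) (j :: nat). \<exists>b\<in>B. g = s [^] i \<otimes> b \<otimes> inv (s [^] j)"
proof -
  have HNN: "HNN_extension G B B s \<tau>" using assms(1) unfolding ascending_HNN_extension_def .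
  then have B: "subgroup B G" and s [simp]: "s \<in> carrier G" and \<tau>: "\<And>b. b \<in> B \<Longrightarrow> \<tau> b \<in> B"
    unfolding HNN_extension_def mon_def hom_def by auto
  interpret B: subgroup B G by fact
  have move: "b \<otimes> s = s \<otimes> \<tau> b" if "b \<in> B" for b
    using HNN_relation[OF HNN that] that \<tau>[OF that]
    by (metis B.mem_carrier inv_solve_left m_assoc m_closed s inv_closed)
  have move_pow: "\<exists>c\<in>B. b \<otimes> s [^] i = s [^] i \<otimes> c" if "b \<in> B" for b and i :: nat
  proof (induction i)
    case 0
    then show ?case using that by (intro bexI[of _ b]) auto
  next
    case (Suc i)
    then obtain c where c: "c \<in> B" "b \<otimes> s [^] i = s [^] i \<otimes> c" by blast
    have "b \<otimes> s [^] Suc i = s [^] i \<otimes> (c \<otimes> s)"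
      using that c by (simp add: m_assoc[symmetric])
    also have "\<dots> = s [^] Suc i \<otimes> \<tau> c" using move c \<tau> by (simp add: m_assoc)
    finally show ?case using \<tau> c by blast
  qed
  show ?thesis
  proof (rule HNN_induct[OF HNN assms(2)])
    show "\<exists>(i :: nat) (j :: nat). \<exists>b\<in>B. \<one> = s [^] i \<otimes> b \<otimes> inv (s [^] j)"
      by (rule exI[of _ 0], rule exI[of _ 0], rule bexI[of _ \<one>]) simp_all
  next
    fix a g assume a: "a \<in> B" and "\<exists>(i :: nat) (j :: nat). \<exists>b\<in>B. g = s [^] i \<otimes> b \<otimes> inv (s [^] j)"
    then obtain i :: nat and j :: nat and b where b: "b \<in> B" "g = s [^] i \<otimes> b \<otimes> inv (s [^] j)" by blast
    obtain c where c: "c \<in> B" "a \<otimes> s [^] i = s [^] i \<otimes> c" using move_pow a by blast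
    have "a \<otimes> g = (a \<otimes> s [^] i) \<otimes> b \<otimes> inv (s [^] j)" using a b by (simp add: m_assoc)
    also have "\<dots> = s [^] i \<otimes> (c \<otimes> b) \<otimes> inv (s [^] j)" using b c by (simp add: m_assoc)
    finally show "\<exists>(i :: nat) (j :: nat). \<exists>b\<in>B. a \<otimes> g = s [^] i \<otimes> b \<otimes> inv (s [^] j)" using b c by blast
  next
    fix g assume "\<exists>(i :: nat) (j :: nat). \<exists>b\<in>B. g = s [^] i \<otimes> b \<otimes> inv (s [^] j)"
    then obtain i :: nat and j :: nat and b where b: "b \<in> B" "g = s [^] i \<otimes> b \<otimes> inv (s [^] j)" by blast
    have "s \<otimes> g = s [^] Suc i \<otimes> b \<otimes> inv (s [^] j)"
      unfolding nat_pow_Suc2[OF s] using b by (simp add: m_assoc)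
    then show "\<exists>(i :: nat) (j :: nat). \<exists>b\<in>B. s \<otimes> g = s [^] i \<otimes> b \<otimes> inv (s [^] j)" using b by blast
  next
    fix g assume "\<exists>(i :: nat) (j :: nat). \<exists>b\<in>B. g = s [^] i \<otimes> b \<otimes> inv (s [^] j)"
    then obtain i :: nat and j :: nat and b where b: "b \<in> B" "g = s [^] i \<otimes> b \<otimes> inv (s [^] j)" by blast
    show "\<exists>(i :: nat) (j :: nat). \<exists>b\<in>B. inv s \<otimes> g = s [^] i \<otimes> b \<otimes> inv (s [^] j)"
    proof (cases i)
      case 0
      \<comment> \<open>No positive power is left to absorb s^-1, so s s^-1 is inserted after
        \<open>b\<close>: then s^-1 b s is \<open>\<tau> b\<close>, and the remaining s^-1 joins the
        negative power on the right.\<close>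
      have "inv s \<otimes> g = inv s \<otimes> b \<otimes> s \<otimes> inv s \<otimes> inv (s [^] j)"
        using b 0 by (simp add: m_assoc)
      also have "\<dots> = s [^] (0 :: nat) \<otimes> \<tau> b \<otimes> inv (s [^] Suc j)"
        using HNN_relation[OF HNN b(1)] b \<tau>[OF b(1)]
        by (simp add: nat_pow_Suc inv_mult_group m_assoc)
      finally show ?thesis using \<tau> b by blast
    next
      case (Suc i')
      have "inv s \<otimes> g = s [^] i' \<otimes> b \<otimes> inv (s [^] j)"
        unfolding b(2) Suc nat_pow_Suc2[OF s] using b by (simp add: m_assoc[symmetric])
      then show ?thesis using b by blast
    qed
  qed
qed

lemma ascending_HNN_image:
  assumes "ascending_HNN_extension G B s \<tau>"
  shows "\<tau> ` B = conjugate G (inv s) B"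
  using assms HNN_relation unfolding ascending_HNN_extension_def conjugate_def
  by (force simp: HNN_extension_def)

lemma ascending_HNN_facts:
  assumes "ascending_HNN_extension G B s \<tau>"
  shows "subgroup B G" "s \<in> carrier G" "\<tau> ` B \<subseteq> B" "\<tau> \<in> mon (G\<lparr>carrier := B\<rparr>) (G\<lparr>carrier := B\<rparr>)"
  using assms unfolding ascending_HNN_extension_def HNN_extension_def mon_def hom_def by auto

lemma subgroup_ascending_HNN_image:
  assumes "ascending_HNN_extension G B s \<tau>"
  shows "subgroup (\<tau> ` B) G"
  unfolding ascending_HNN_image[OF assms]
  using ascending_HNN_facts[OF assms] by (simp add: subgroup_conjugate)

lemma ascending_HNN_over_image:
  assumes asc: "ascending_HNN_extension G A t \<phi>"
  shows "ascending_HNN_extension G (\<phi> ` A) t \<phi>"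
proof -
  note facts = ascending_HNN_facts[OF asc]
  have HNN: "HNN_extension G A A t \<phi>" using asc unfolding ascending_HNN_extension_def .
  then have pres: "has_presentation G (case_option t id) (insert None (Some ` A)) (HNN_rels G A A \<phi>)"
    unfolding HNN_extension_def by blast
  have inj: "inj_on \<phi> A" and mult: "\<And>a b. a \<in> A \<Longrightarrow> b \<in> A \<Longrightarrow> \<phi> (a \<otimes> b) = \<phi> a \<otimes> \<phi> b"
    and A: "\<And>a b. a \<in> A \<Longrightarrow> b \<in> A \<Longrightarrow> a \<otimes> b \<in> A" and \<phi>A: "\<And>a. a \<in> A \<Longrightarrow> \<phi> a \<in> A"
    using facts subgroup.m_closed unfolding mon_def hom_def by auto
  define \<psi> where "\<psi> = inv_into A \<phi>"
  have \<psi>: "\<And>a. a \<in> A \<Longrightarrow> \<psi> (\<phi> a) = a" using inj by (simp add: \<psi>_def)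
  let ?p = "map_option \<phi>" and ?q = "map_option \<psi>" and ?Y = "insert None (Some ` \<phi> ` A)"
    and ?S = "HNN_rels G (\<phi> ` A) (\<phi> ` A) \<phi>"
  have "has_presentation G (case_option t id) ?Y ?S"
  proof (rule has_presentation_iso[OF pres is_group conj_inv_iso[OF facts(2)], of ?p _ ?q])
    fix l r assume "(l, r) \<in> HNN_rels G A A \<phi>"
    then show "(map (apfst ?p) l, map (apfst ?p) r) \<in> ?S"
      unfolding HNN_rels_def table_rels_def using mult \<phi>A by force
  next
    fix l r assume "(l, r) \<in> ?S"
    then consider (table) a b where "a \<in> A" "b \<in> A" "l = [(Some (\<phi> a), True), (Some (\<phi> b), True)]"
        "r = [(Some (\<phi> (a \<otimes> b)), True)]"
      | (stable) a where "a \<in> A" "l = [(None, False), (Some (\<phi> a), True), (None, True)]"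
        "r = [(Some (\<phi> (\<phi> a)), True)]"
      unfolding HNN_rels_def table_rels_def using mult by auto
    then show "(map (apfst ?q) l, map (apfst ?q) r) \<in> HNN_rels G A A \<phi>"
      by cases (auto simp: HNN_rels_def table_rels_def \<psi> A \<phi>A)
  next
    show "?S \<subseteq> words ?Y \<times> words ?Y"
      unfolding HNN_rels_def table_rels_def using mult A \<phi>A by (force simp flip: mult)
  next
    fix x assume "x \<in> insert None (Some ` A)"
    then show "case_option t id (?p x) = inv t \<otimes> case_option t id x \<otimes> t"
      using facts(2) HNN_relation[OF HNN] by auto
  qed (auto simp: \<psi>)
  moreover have "\<phi> \<in> mon (G\<lparr>carrier := \<phi> ` A\<rparr>) (G\<lparr>carrier := \<phi> ` A\<rparr>)"
    using mult \<phi>A inj unfolding mon_def hom_def inj_on_def by auto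
  ultimately show ?thesis
    unfolding ascending_HNN_extension_def HNN_extension_def
    using facts subgroup_ascending_HNN_image[OF asc] by auto
qed

lemma finite_index_if_minimal:
  assumes asc: "ascending_HNN_extension G A t \<phi>" and "minimal_splitting_subgroup G A"
  shows "finite_index_in G (\<phi> ` A) A"
proof (rule ccontr)
  assume inf: "\<not> finite_index_in G (\<phi> ` A) A"
  note sub = subgroup_ascending_HNN_image[OF asc]
  have "\<phi> ` A \<inter> A = \<phi> ` A" using ascending_HNN_facts[OF asc] by blast
  moreover have "finite_index_in G (\<phi> ` A \<inter> \<phi> ` A) (\<phi> ` A)"
    using finite_index_in_Int_iff_almost_contained[OF sub sub]
      almost_contained_subset[OF order_refl] subgroup.subset[OF sub] by blast
  ultimately have "smaller G (\<phi> ` A) A" using inf unfolding smaller_def by simp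
  moreover have "splits_nontrivially_over G (\<phi> ` A)"
    using ascending_HNN_over_image[OF asc]
    unfolding splits_nontrivially_over_def ascending_HNN_extension_def by blast
  ultimately show False
    using assms(2) sub unfolding minimal_splitting_subgroup_def by blast
qed

text \<open>The elements \<open>g\<close> satisfying the conclusion form a submonoid; it contains \<open>t\<close> since
  \<open>A \<subseteq> tAt\<inverse>\<close>, and \<open>t\<inverse>\<close> since \<open>\<phi>(A) = t\<inverse>At\<close> has finite index in \<open>A\<close>.\<close>

lemma almost_contained_all_conjugates:
  assumes asc: "ascending_HNN_extension G A t \<phi>" and fin: "finite_index_in G (\<phi> ` A) A"
    and g: "g \<in> carrier G"
  shows "almost_contained G A (conjugate G g A)"
proof -
  note facts = ascending_HNN_facts[OF asc]
  have HNN: "HNN_extension G A A t \<phi>" using asc unfolding ascending_HNN_extension_def .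
  have AG: "A \<subseteq> carrier G" using facts(1) by (rule subgroup.subset)
  \<comment> \<open>Conjugating the almost containment for \<open>k\<close> by \<open>h\<close>
    almost contains the conjugate of \<open>A\<close> by \<open>h\<close> in its conjugate by
    \<open>h \<otimes> k\<close>; transitivity then links \<open>A\<close> to the latter.\<close>
  have mult: "almost_contained G A (conjugate G (h \<otimes> k) A)"
    if "h \<in> carrier G" "k \<in> carrier G"
      "almost_contained G A (conjugate G h A)" "almost_contained G A (conjugate G k A)" for h k
    using almost_contained_trans[OF that(3)]
      almost_contained_conjugate[OF that(4,1)] that AG
    by (simp add: conjugate_mult conjugate_closed)
  have tinv: "almost_contained G A (conjugate G (inv t) A)"
    using finite_index_in_Int_iff_almost_contained[OF facts(1) subgroup_ascending_HNN_image[OF asc]]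
      fin facts(3) by (simp add: Int_absorb1 ascending_HNN_image[OF asc])
  have "conjugate G (inv t) A \<subseteq> A" using facts(3) ascending_HNN_image[OF asc] by simp
  then have "conjugate G t (conjugate G (inv t) A) \<subseteq> conjugate G t A"
    unfolding conjugate_def by blast
  then have "A \<subseteq> conjugate G t A"
    using facts AG by (simp add: conjugate_mult conjugate_one)
  then have t: "almost_contained G A (conjugate G t A)"
    using AG facts(2) by (intro almost_contained_subset conjugate_closed)
  show ?thesis
  proof (rule HNN_induct[OF HNN g])
    show "almost_contained G A (conjugate G \<one> A)"
      using AG by (simp add: conjugate_one almost_contained_subset)
  next
    fix a g assume "a \<in> A" "g \<in> carrier G" "almost_contained G A (conjugate G g A)"
    moreover from this have "almost_contained G A (conjugate G a A)"
      using AG by (simp add: conjugate_subgroup_elem[OF facts(1)] almost_contained_subset)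
    ultimately show "almost_contained G A (conjugate G (a \<otimes> g) A)"
      using mult[of a g] AG by blast
  qed (use mult t tinv facts(2) in auto)
qed

section \<open>Comparing two ascending splittings\<close>

lemma finitely_generated_subset_conjugate:
  assumes fg: "finitely_generated_subgroup G A" and HNN: "HNN_extension G A H t \<phi>"
    and asc: "ascending_HNN_extension G B s \<tau>" and BA: "almost_contained G B A"
  shows "\<exists>n :: nat. A \<subseteq> conjugate G (s [^] n) B"
proof -
  note facts = ascending_HNN_facts[OF asc]
  interpret B: subgroup B G by (rule facts(1))
  note s [simp] = facts(2)
  have A: "subgroup A G" and t: "t \<in> carrier G" using HNN unfolding HNN_extension_def by auto
  have AG: "A \<subseteq> carrier G" using A by (rule subgroup.subset)
  obtain \<chi> :: "'a \<Rightarrow> int"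
    where hom: "\<And>g h. g \<in> carrier G \<Longrightarrow> h \<in> carrier G \<Longrightarrow> \<chi> (g \<otimes> h) = \<chi> g + \<chi> h"
      and \<chi>t: "\<chi> t = 1" and \<chi>A: "\<And>a. a \<in> A \<Longrightarrow> \<chi> a = 0"
    using HNN_height[OF HNN] by metis
  have \<chi>one: "\<chi> \<one> = 0" using hom[of \<one> \<one>] by simp
  have \<chi>inv: "\<chi> (inv g) = - \<chi> g" if "g \<in> carrier G" for g
    using hom[of g "inv g"] that \<chi>one by simp
  have \<chi>pow: "\<chi> (g [^] n) = int n * \<chi> g" if "g \<in> carrier G" for g and n :: nat
    by (induction n) (use that hom \<chi>one in \<open>auto simp: algebra_simps\<close>)
  \<comment> \<open>As \<open>A\<close> has height 0, the heights on \<open>B\<close> are among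
    those of the finitely many translates, whereas the powers of an element of nonzero height take
    infinitely many heights.\<close>
  have \<chi>B: "\<chi> b = 0" if b: "b \<in> B" for b
  proof (rule ccontr)
    assume nz: "\<chi> b \<noteq> 0"
    obtain F where F: "finite F" "F \<subseteq> carrier G" "B \<subseteq> A <#> F"
      using BA unfolding almost_contained_def by blast
    have "\<chi> ` B \<subseteq> \<chi> ` F"
    proof
      fix z assume "z \<in> \<chi> ` B"
      then obtain a f where "a \<in> A" "f \<in> F" "z = \<chi> (a \<otimes> f)"
        using F(3) unfolding set_mult_def by blast
      then show "z \<in> \<chi> ` F" using hom[of a f] F(2) AG \<chi>A by auto
    qed
    then have "finite (\<chi> ` B)" using F(1) finite_surj by blast
    moreover have "b [^] n \<in> B" for n :: nat by (induction n) (use b in auto)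
    then have "range (\<lambda>n :: nat. int n * \<chi> b) \<subseteq> \<chi> ` B"
      using \<chi>pow[OF B.mem_carrier[OF b]] by (metis image_eqI image_subsetI)
    ultimately have "finite (range (\<lambda>n :: nat. int n * \<chi> b))" using finite_subset by blast
    moreover have "inj (\<lambda>n :: nat. int n * \<chi> b)" using nz by (auto intro: injI)
    ultimately show False using finite_imageD infinite_UNIV_nat by blast
  qed
  have height: "\<chi> (s [^] i \<otimes> b \<otimes> inv (s [^] j)) = (int i - int j) * \<chi> s"
    if "b \<in> B" for b and i :: nat and j :: nat
    using that \<chi>B by (simp add: hom \<chi>inv \<chi>pow algebra_simps)
  \<comment> \<open>If \<open>s\<close> had height 0, so would every normal form, but
    \<open>t\<close> has height 1.\<close>
  have \<chi>s: "\<chi> s \<noteq> 0"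
    using ascending_HNN_normal_form[OF asc t] height \<chi>t by force
  have elem: "\<exists>n :: nat. a \<in> conjugate G (s [^] n) B" if a: "a \<in> A" for a
  proof -
    obtain i :: nat and j :: nat and b where b: "b \<in> B" "a = s [^] i \<otimes> b \<otimes> inv (s [^] j)"
      using ascending_HNN_normal_form[OF asc] a AG by blast
    then have "i = j" using height[OF b(1), of i j] \<chi>A[OF a] \<chi>s by simp
    then show ?thesis using b unfolding conjugate_def by blast
  qed
  have "conjugate G (inv s) B \<subseteq> B" using facts(3) ascending_HNN_image[OF asc] by simp
  then have "conjugate G s (conjugate G (inv s) B) \<subseteq> conjugate G s B"
    unfolding conjugate_def by blast
  then have up: "B \<subseteq> conjugate G s B"
    by (simp add: conjugate_mult conjugate_one B.subset)
  have "conjugate G (s [^] n) B \<subseteq> conjugate G (s [^] Suc n) B" for n :: nat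
  proof -
    have "conjugate G (s [^] n) B \<subseteq> conjugate G (s [^] n) (conjugate G s B)"
      using up unfolding conjugate_def by blast
    then show ?thesis by (simp add: conjugate_mult B.subset)
  qed
  then have mono: "conjugate G (s [^] m) B \<subseteq> conjugate G (s [^] n) B" if "m \<le> n" for m n :: nat
    using lift_Suc_mono_le[of "\<lambda>n. conjugate G (s [^] n) B"] that by blast
  obtain S where S: "finite S" "S \<subseteq> A" "generate G S = A"
    using fg unfolding finitely_generated_subgroup_def by blast
  \<comment> \<open>Each generator has its own exponent; a common bound on the finite set
    \<open>S\<close> gives one conjugate containing all of them.\<close>
  obtain N :: "'a \<Rightarrow> nat" where N: "\<And>a. a \<in> S \<Longrightarrow> a \<in> conjugate G (s [^] N a) B"
    using elem S(2) by (metis subsetD)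
  obtain n where n: "\<And>a. a \<in> S \<Longrightarrow> N a \<le> n"
    using S(1) by (metis finite_imageI finite_nat_set_iff_bounded_le imageI)
  have "S \<subseteq> conjugate G (s [^] n) B" using N n mono by blast
  then have "generate G S \<subseteq> conjugate G (s [^] n) B"
    by (intro generate_subgroup_incl subgroup_conjugate facts(1)) simp_all
  then show ?thesis using S(3) by blast
qed

text \<open>Once \<open>A\<close> lies in the conjugate of \<open>B\<close> by some
  \<open>?g\<close>, the finite index hypothesis makes it possible to undo this conjugation up to
  finite index, on the side of \<open>A\<close> or on that of \<open>B\<close>.\<close>

lemma not_smaller_if_finite_index_image:
  assumes fg: "finitely_generated_subgroup G A"
    and ascA: "ascending_HNN_extension G A t \<phi>" and ascB: "ascending_HNN_extension G B s \<tau>"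
    and fin: "finite_index_in G (\<phi> ` A) A \<or> finite_index_in G (\<tau> ` B) B"
  shows "\<not> smaller G B A"
proof
  assume sm: "smaller G B A"
  note A = ascending_HNN_facts[OF ascA] and B = ascending_HNN_facts[OF ascB]
  have AG: "A \<subseteq> carrier G" and BG: "B \<subseteq> carrier G" using A(1) B(1) subgroup.subset by auto
  have BA: "almost_contained G B A" and AB: "\<not> almost_contained G A B"
    using sm finite_index_in_Int_iff_almost_contained[OF B(1) A(1)]
      finite_index_in_Int_iff_almost_contained[OF A(1) B(1)]
    unfolding smaller_def by (simp_all add: Int_commute)
  obtain n :: nat where n: "A \<subseteq> conjugate G (s [^] n) B"
    using finitely_generated_subset_conjugate[OF fg _ ascB BA] ascA
    unfolding ascending_HNN_extension_def by blast
  let ?g = "s [^] n"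
  have g: "?g \<in> carrier G" using B(2) by simp
  from fin show False
  proof
    assume "finite_index_in G (\<phi> ` A) A"
    \<comment> \<open>Here \<open>A\<close> is replaced by its conjugate under the inverse of
      \<open>?g\<close>, which lies in \<open>B\<close>.\<close>
    then have "almost_contained G A (conjugate G (inv ?g) A)"
      using almost_contained_all_conjugates[OF ascA] g by simp
    moreover have "conjugate G (inv ?g) A \<subseteq> conjugate G (inv ?g) (conjugate G ?g B)"
      using n unfolding conjugate_def by blast
    then have "conjugate G (inv ?g) A \<subseteq> B"
      using g BG by (simp add: conjugate_mult conjugate_one)
    ultimately show False
      using AB almost_contained_trans[OF _ almost_contained_subset[OF _ BG] BG] by blast
  next
    assume "finite_index_in G (\<tau> ` B) B"
    \<comment> \<open>Here \<open>B\<close> is almost contained in its conjugate by the inverse of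
      \<open>?g\<close>. Conjugating by \<open>?g\<close> shows that the conjugate of
      \<open>B\<close> containing \<open>A\<close> is almost contained in \<open>B\<close>.\<close>
    then have "almost_contained G B (conjugate G (inv ?g) B)"
      using almost_contained_all_conjugates[OF ascB] g by simp
    then have "almost_contained G (conjugate G ?g B) (conjugate G ?g (conjugate G (inv ?g) B))"
      using g BG by (intro almost_contained_conjugate conjugate_closed) simp_all
    then have "almost_contained G (conjugate G ?g B) B"
      using g BG by (simp add: conjugate_mult conjugate_one)
    then show False
      using AB almost_contained_trans[OF almost_contained_subset[OF n conjugate_closed[OF g BG]] _ BG]
      by blast
  qed
qed

end

theorem theorem39:
  fixes G :: "('a, 'm) monoid_scheme" and A :: "'a set" and t :: 'a and \<phi> :: "'a \<Rightarrow> 'a"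
  assumes "group G"
    and "finitely_generated_subgroup G A"
    and "\<phi> \<in> mon (G\<lparr>carrier := A\<rparr>) (G\<lparr>carrier := A\<rparr>)"
    and "ascending_HNN_extension G A t \<phi>"
  shows "(\<not> finite_index_in G (\<phi> ` A) A \<longrightarrow>
            \<not> minimal_splitting_subgroup G A \<and>
            \<not> (\<exists>B. finitely_generated_subgroup G B \<and> smaller G B A \<and>
                  splits_as_ascending_HNN_over G B \<and> minimal_splitting_subgroup G B)) \<and>
         (finite_index_in G (\<phi> ` A) A \<longrightarrow>
            \<not> (\<exists>B. finitely_generated_subgroup G B \<and> smaller G B A \<and>
                  splits_as_ascending_HNN_over G B))"
proof -
  interpret group G by fact
  show ?thesis
    \<comment> \<open>In the infinite index case, minimality of \<open>B\<close> provides the finite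
      index of \<open>\<tau>\<close>
      B\<open>in\<close>B\<open>; in the other case the finite index of\<close>\<phi>
      \<open>A\<close> in \<open>A\<close> is given.\<close>
    using finite_index_if_minimal not_smaller_if_finite_index_image[OF assms(2,4)] assms(4)
    unfolding splits_as_ascending_HNN_over_def by blast
qed

end
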